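(* For every integer $h\geq 1$, there is a poset of height $h$ whose cover graph is planar and whose dimension is at least $2h-2$.
   Context: All posets are finite. The height of a poset is the maximum size of a chain in it. The dimension of a poset $P$ is the least integer $d$ such that $P$ is the intersection of $d$ linear orders. A cover relation of $P$ is a relation $a\leq b$ in $P$ with $a\neq b$ such that there is no element $c$ distinct from $a,b$ with $a\leq c\leq b$ in $P$. The cover graph of $P$ is the undirected graph whose vertices are the elements of $P$ and in which two elements are adjacent if they are in a cover relation in $P$. The planarity required here is planarity of the cover graph as an undirected graph (not of the upward-drawn diagram). *)

theory Defs
  imports "HOL-Analysis.Analysis"
begin

text \<open>
  A finite poset is a finite carrier \<open>A\<close> together with a relation \<open>r\<close> such that
  \<open>partial_order_on A r\<close>, where \<open>(a, b) \<in> r\<close> means $a \leq b$; this includes \<open>r \<subseteq> A \<times> A\<close>.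
\<close>

text \<open>
  Since \<open>r\<close> is reflexive exactly on the carrier, \<open>Chains r\<close> consists of subsets of the carrier;
  it always contains the empty chain.
\<close>

definition poset_height :: "('a \<times> 'a) set \<Rightarrow> nat" where
  "poset_height r = Max (card ` Chains r)"

text \<open>
  The condition \<open>R \<noteq> {}\<close> is needed because \<open>\<Inter>{} = UNIV\<close>; a nonempty linear order has
  dimension 1. Every finite poset has a realizer, so \<open>LEAST\<close> is well defined there.
\<close>

definition realizer :: "'a set \<Rightarrow> ('a \<times> 'a) set \<Rightarrow> ('a \<times> 'a) set set \<Rightarrow> bool" where
  "realizer A r R \<longleftrightarrow> R \<noteq> {} \<and> (\<forall>L\<in>R. linear_order_on A L) \<and> \<Inter>R = r"

definition poset_dimension :: "'a set \<Rightarrow> ('a \<times> 'a) set \<Rightarrow> nat" where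
  "poset_dimension A r = (LEAST d. \<exists>R. realizer A r R \<and> finite R \<and> card R = d)"

definition cover_rel :: "('a \<times> 'a) set \<Rightarrow> 'a \<Rightarrow> 'a \<Rightarrow> bool" where
  "cover_rel r a b \<longleftrightarrow>
     (a, b) \<in> r \<and> a \<noteq> b \<and> \<not> (\<exists>c. c \<noteq> a \<and> c \<noteq> b \<and> (a, c) \<in> r \<and> (c, b) \<in> r)"

definition cover_edges :: "('a \<times> 'a) set \<Rightarrow> 'a set set" where
  "cover_edges r = {{a, b} | a b. cover_rel r a b}"

text \<open>
  Planarity of the undirected simple graph with vertex set \<open>V\<close> and edge set \<open>E\<close> (two-element
  subsets of \<open>V\<close>): there is a drawing in the plane, identified with \<open>\<complex>\<close>, that places the vertices
  at distinct points \<open>p v\<close> and draws each edge \<open>e\<close> as a simple arc \<open>\<gamma> e\<close> joining its two ends, such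
  that an arc passes through no vertex other than its ends and two distinct arcs meet at most in
  common ends. Edges need not be drawn monotonically.
\<close>

definition plane_drawing ::
  "'a set \<Rightarrow> 'a set set \<Rightarrow> ('a \<Rightarrow> complex) \<Rightarrow> ('a set \<Rightarrow> real \<Rightarrow> complex) \<Rightarrow> bool" where
  "plane_drawing V E p \<gamma> \<longleftrightarrow>
     inj_on p V \<and>
     (\<forall>e\<in>E. arc (\<gamma> e) \<and> {pathstart (\<gamma> e), pathfinish (\<gamma> e)} = p ` e \<and>
            path_image (\<gamma> e) \<inter> p ` V = p ` e) \<and>
     (\<forall>e\<in>E. \<forall>f\<in>E. e \<noteq> f \<longrightarrow> path_image (\<gamma> e) \<inter> path_image (\<gamma> f) \<subseteq> p ` (e \<inter> f))"

definition planar :: "'a set \<Rightarrow> 'a set set \<Rightarrow> bool" where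
  "planar V E \<longleftrightarrow> (\<exists>p \<gamma>. plane_drawing V E p \<gamma>)"

end

theory Submission
  imports Defs
begin

text \<open>
  Put \<open>n = h - 1\<close>. The arcs of the cycle \<open>\<int>/n\<close> of length at most \<open>n - 1\<close>, ordered by inclusion, form a
  planar grid on a cylinder: a level \<open>l\<close> consists of the \<open>n\<close> arcs of length \<open>l\<close>, and each arc is covered
  by its two extensions. The singletons \<open>a i\<close> are the minimal elements, and an element \<open>b i\<close> above the arc
  that misses only \<open>i\<close> completes a standard example of dimension \<open>n\<close>, in which all the \<open>b i\<close> lie
  on one face. The same face has room for an element \<open>x\<close> above all the \<open>a i\<close>, placed over two
  neighbouring arcs of length \<open>n - 1\<close>.

  Take a second copy of this poset with top \<open>x'\<close>, and glue the two cylinders along these faces,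
  putting \<open>x\<close> below every \<open>b' i\<close> and \<open>x'\<close> below every \<open>b i\<close>. The two standard examples become one of
  dimension \<open>2 * n\<close>, while longest chains, such as a path from some \<open>a i\<close> through \<open>x\<close> to some \<open>b' j\<close>,
  have \<open>n + 1\<close> elements. On the cylinder all edges are straight segments between consecutive rows, and
  two of them are disjoint because their bottom and top abscissae are ordered alike.
\<close>

section \<open>Realizers and standard examples\<close>

text \<open>The added pairs are exactly those forced by transitivity once \<open>x\<close> is put
  below \<open>y\<close>; a cycle through one of them would already give
  \<open>(y, x) \<in> r\<close>.\<close>

lemma partial_order_insert:
  assumes r: "partial_order_on A r" and xy: "x \<in> A" "y \<in> A" "(y, x) \<notin> r"
  shows "partial_order_on A (r \<union> {(p, q). (p, x) \<in> r \<and> (y, q) \<in> r})"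
proof -
  have rf: "r \<subseteq> A \<times> A" "refl_on A r" and tr: "trans r" and an: "antisym r"
    using r by (auto simp: partial_order_on_def preorder_on_def)
  let ?s = "r \<union> {(p, q). (p, x) \<in> r \<and> (y, q) \<in> r}"
  have "?s \<subseteq> A \<times> A" "refl_on A ?s"
    using rf by (auto simp: refl_on_def)
  moreover have "trans ?s"
    unfolding trans_def using xy(3) tr[unfolded trans_def] by blast
  moreover have "antisym ?s"
    unfolding antisym_def using xy(3) tr[unfolded trans_def] an[unfolded antisym_def] by blast
  ultimately show ?thesis
    by (simp add: partial_order_on_def preorder_on_def)
qed

text \<open>Szpilrajn's theorem for finite carriers: an inclusion-maximal partial order above
  \<open>r\<close> is total, since an incomparable pair could still be inserted.\<close>

lemma linear_extension_exists:
  assumes fin: "finite A" and r: "partial_order_on A r"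
  shows "\<exists>L. linear_order_on A L \<and> r \<subseteq> L"
proof -
  let ?P = "{s. partial_order_on A s \<and> r \<subseteq> s}"
  have "?P \<subseteq> Pow (A \<times> A)"
    by (auto simp: partial_order_on_def preorder_on_def)
  hence "finite ?P"
    using fin by (meson finite_Pow_iff finite_SigmaI finite_subset)
  moreover have "r \<in> ?P" using r by simp
  ultimately have "\<exists>L\<in>?P. r \<subseteq> L \<and> (\<forall>s\<in>?P. L \<subseteq> s \<longrightarrow> L = s)"
    by (rule finite_has_maximal2)
  then obtain L where L: "L \<in> ?P" "\<And>s. s \<in> ?P \<Longrightarrow> L \<subseteq> s \<Longrightarrow> L = s"
    by (elim bexE conjE) simp
  have "(x, y) \<in> L" if "x \<in> A" "y \<in> A" "(y, x) \<notin> L" for x y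
  proof -
    let ?s = "L \<union> {(p, q). (p, x) \<in> L \<and> (y, q) \<in> L}"
    have "?s \<in> ?P"
      using partial_order_insert[of A L x y] that L(1) by auto
    hence "L = ?s" using L(2) by blast
    moreover have "(x, x) \<in> L" "(y, y) \<in> L"
      using L(1) that by (auto simp: partial_order_on_def preorder_on_def refl_on_def)
    ultimately show ?thesis by blast
  qed
  hence "total_on A L" by (auto simp: total_on_def)
  with L(1) show ?thesis by (auto simp: linear_order_on_def)
qed

text \<open>Ensures that the \<open>LEAST\<close> in \<open>poset_dimension\<close> is attained. The
  set of all linear extensions is a realizer: a pair outside \<open>r\<close> can be reversed and
  the result extended.\<close>

lemma finite_realizer_exists:
  assumes fin: "finite A" and r: "partial_order_on A r"
  shows "\<exists>R. realizer A r R \<and> finite R"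
proof -
  let ?R = "{L. linear_order_on A L \<and> r \<subseteq> L}"
  have sub: "L \<subseteq> A \<times> A" if "linear_order_on A L" for L
    using that by (auto simp: linear_order_on_def partial_order_on_def preorder_on_def)
  have "finite ?R"
    using fin sub by (intro finite_subset[of ?R "Pow (A \<times> A)"]) auto
  moreover have ne: "?R \<noteq> {}"
    using linear_extension_exists[OF fin r] by blast
  moreover have "(x, y) \<in> r" if xy: "(x, y) \<in> \<Inter>?R" for x y
  proof (rule ccontr)
    assume n: "(x, y) \<notin> r"
    have A: "x \<in> A" "y \<in> A" using xy ne sub by blast+
    let ?s = "r \<union> {(p, q). (p, y) \<in> r \<and> (x, q) \<in> r}"
    obtain L where L: "linear_order_on A L" "?s \<subseteq> L"
      using linear_extension_exists[OF fin partial_order_insert[OF r A(2,1) n]] by blast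
    have "(x, x) \<in> r" "(y, y) \<in> r"
      using r A by (auto simp: partial_order_on_def preorder_on_def refl_on_def)
    hence "(y, x) \<in> L" "x \<noteq> y" using L(2) n by auto
    moreover have "(x, y) \<in> L" using xy L by auto
    ultimately show False
      using L(1) by (auto simp: linear_order_on_def partial_order_on_def antisym_def)
  qed
  hence "\<Inter>?R = r" by (intro subset_antisym subrelI) auto
  ultimately have "realizer A r ?R" by (simp add: realizer_def)
  with \<open>finite ?R\<close> show ?thesis by (intro exI[of _ ?R] conjI)
qed

text \<open>One linear order cannot reverse two of the pairs \<open>(a i, b i)\<close>: reversing
  those of \<open>i\<close> and \<open>j\<close> gives the path \<open>a i\<close>,
  \<open>b j\<close>, \<open>a j\<close>, \<open>b i\<close>, hence \<open>a i\<close> below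
  \<open>b i\<close>. So distinct indices need distinct members of a realizer.\<close>

lemma card_le_poset_dimension:
  assumes fin: "finite A" and r: "partial_order_on A r"
    and mem: "\<And>i. i \<in> I \<Longrightarrow> a i \<in> A \<and> b i \<in> A"
    and inc: "\<And>i. i \<in> I \<Longrightarrow> (a i, b i) \<notin> r"
    and cmp: "\<And>i j. i \<in> I \<Longrightarrow> j \<in> I \<Longrightarrow> i \<noteq> j \<Longrightarrow> (a i, b j) \<in> r"
  shows "card I \<le> poset_dimension A r"
proof -
  have "\<exists>R. realizer A r R \<and> finite R \<and> card R = poset_dimension A r"
    unfolding poset_dimension_def
    by (rule LeastI_ex) (use finite_realizer_exists[OF fin r] in blast)
  then obtain R where R: "realizer A r R" "finite R" "card R = poset_dimension A r" by blast
  have lin: "linear_order_on A L" and sub: "r \<subseteq> L" if "L \<in> R" for L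
    using R(1) that by (auto simp: realizer_def)
  have "\<forall>i\<in>I. \<exists>L\<in>R. (a i, b i) \<notin> L"
    using R(1) inc by (auto simp: realizer_def)
  then obtain f where f: "\<And>i. i \<in> I \<Longrightarrow> f i \<in> R \<and> (a i, b i) \<notin> f i"
    by metis
  have rev: "(b i, a i) \<in> f i" if "i \<in> I" for i
  proof (cases "a i = b i")
    case True
    thus ?thesis
      using lin[of "f i"] f[OF that] mem[OF that]
      by (auto simp: linear_order_on_def partial_order_on_def preorder_on_def refl_on_def)
  next
    case False
    thus ?thesis
      using lin[of "f i"] f[OF that] mem[OF that]
      by (auto simp: linear_order_on_def total_on_def)
  qed
  have "inj_on f I"
  proof (rule inj_onI, rule ccontr)
    fix i j assume ij: "i \<in> I" "j \<in> I" "f i = f j" "i \<noteq> j"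
    have "trans (f i)"
      using lin[of "f i"] f ij(1) by (auto simp: linear_order_on_def partial_order_on_def preorder_on_def)
    moreover have "(a i, b j) \<in> f i" "(a j, b i) \<in> f i"
      using cmp ij f sub by (metis subsetD)+
    moreover have "(b j, a j) \<in> f i" using rev[OF ij(2)] ij(3) by simp
    ultimately have "(a i, b i) \<in> f i" by (meson transD)
    thus False using f ij(1) by blast
  qed
  moreover have "f ` I \<subseteq> R" using f by blast
  ultimately show ?thesis using R(2,3) by (metis card_inj_on_le)
qed

section \<open>Posets generated by graded digraphs\<close>

text \<open>A strictly increasing level function is injective on chains, so no chain has more
  elements than there are levels.\<close>

lemma poset_height_eqI:
  assumes fin: "finite A" and r: "partial_order_on A r"
    and lev: "\<And>u. u \<in> A \<Longrightarrow> 1 \<le> lev u \<and> lev u \<le> h"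
    and mono: "\<And>u v. (u, v) \<in> r \<Longrightarrow> u \<noteq> v \<Longrightarrow> lev u < (lev v :: nat)"
    and chain: "C \<in> Chains r" "card C = h"
  shows "poset_height r = h"
  unfolding poset_height_def
proof (rule Max_eqI)
  have sub: "C \<subseteq> A" if "C \<in> Chains r" for C
    using that r by (fastforce simp: Chains_def partial_order_on_def preorder_on_def)
  show "finite (card ` Chains r)"
  proof (rule finite_imageI)
    have "Chains r \<subseteq> Pow A" using sub by blast
    thus "finite (Chains r)" using fin by (meson finite_Pow_iff finite_subset)
  qed
  show "h \<in> card ` Chains r" using chain by blast
  fix k assume "k \<in> card ` Chains r"
  then obtain D where D: "D \<in> Chains r" "k = card D" by blast
  have "inj_on lev D"
  proof (rule inj_onI, rule ccontr)
    fix u v assume "u \<in> D" "v \<in> D" "lev u = lev v" "u \<noteq> v"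
    moreover from this have "(u, v) \<in> r \<or> (v, u) \<in> r" using D(1) by (auto simp: Chains_def)
    ultimately show False using mono by (metis less_irrefl)
  qed
  moreover have "lev ` D \<subseteq> {1..h}" using sub[OF D(1)] lev by auto
  ultimately have "card D \<le> card {1..h}" by (intro card_inj_on_le[of lev]) auto
  thus "k \<le> h" using D(2) by simp
qed

text \<open>\<open>E\<^sup>*\<close> is reflexive on the whole type and is therefore cut down to the
  carrier.\<close>

definition digraph_order :: "'a set \<Rightarrow> ('a \<times> 'a) set \<Rightarrow> ('a \<times> 'a) set" where
  "digraph_order A E = {(u, v). u \<in> A \<and> v \<in> A \<and> (u, v) \<in> E\<^sup>*}"

lemma rtrancl_graded:
  assumes "\<And>u v. (u, v) \<in> E \<Longrightarrow> lev u < (lev v :: nat)" and "(u, v) \<in> E\<^sup>*"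
  shows "u = v \<or> lev u < lev v"
  using assms(2)
proof induction
  case (step v w)
  with assms(1)[OF step.hyps(2)] show ?case by auto
qed simp

lemma partial_order_digraph_order:
  assumes "\<And>u v. (u, v) \<in> E \<Longrightarrow> lev u < (lev v :: nat)"
  shows "partial_order_on A (digraph_order A E)"
proof -
  have "antisym (digraph_order A E)"
    using rtrancl_graded[of E lev, OF assms] unfolding antisym_def digraph_order_def
    by (blast dest: less_asym)
  moreover have "trans (digraph_order A E)"
    unfolding trans_def digraph_order_def by (blast intro: rtrancl_trans)
  ultimately show ?thesis
    by (auto simp: partial_order_on_def preorder_on_def refl_on_def digraph_order_def)
qed

text \<open>The first arc of a path from \<open>u\<close> to \<open>v\<close> ends at some
  \<open>w\<close> in between, and a cover leaves only \<open>w = v\<close>. So a drawing of all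
  arcs suffices, and the covers need not be determined.\<close>

lemma cover_rel_digraph_order:
  assumes E: "E \<subseteq> A \<times> A" and grad: "\<And>u v. (u, v) \<in> E \<Longrightarrow> lev u < (lev v :: nat)"
    and cov: "cover_rel (digraph_order A E) u v"
  shows "(u, v) \<in> E"
proof -
  have uv: "u \<in> A" "v \<in> A" "(u, v) \<in> E\<^sup>*" "u \<noteq> v"
    using cov by (auto simp: cover_rel_def digraph_order_def)
  then obtain w where w: "(u, w) \<in> E" "(w, v) \<in> E\<^sup>*"
    by (metis converse_rtranclE)
  have "w \<in> A" "w \<noteq> u" using w(1) E grad by blast+
  hence "w = v"
    using cov w uv unfolding cover_rel_def digraph_order_def by blast
  thus ?thesis using w(1) by simp
qed

section \<open>Layered drawings on a cylinder\<close>

text \<open>The exponential map identifies the cylinder of circumference \<open>N\<close> with the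
  punctured plane: height \<open>y\<close> becomes the circle of radius
  \<open>exp y\<close>.\<close>

definition cyl :: "int \<Rightarrow> real \<Rightarrow> real \<Rightarrow> complex" where
  "cyl N y x = exp (Complex y (2 * pi * x / of_int N))"

lemma cyl_eq_iff:
  assumes "N > 0"
  shows "cyl N y x = cyl N y' x' \<longleftrightarrow> y = y' \<and> (\<exists>k::int. x = x' + of_int (N * k))"
proof -
  have "(2 * pi * x / of_int N = 2 * pi * x' / of_int N + of_int (2 * k) * pi) \<longleftrightarrow>
        x = x' + of_int (N * k)" for k :: int
  proof -
    have "2 * pi * x' / of_int N + of_int (2 * k) * pi = (2 * pi / of_int N) * (x' + of_int (N * k))"
      using assms by (simp add: field_simps)
    moreover have "2 * pi * x / of_int N = (2 * pi / of_int N) * x"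
      by simp
    moreover have "2 * pi / of_int N \<noteq> (0::real)" using assms by simp
    ultimately show ?thesis by (metis mult_left_cancel)
  qed
  moreover have "cyl N y x = cyl N y' x' \<longleftrightarrow> y = y' \<and>
      (\<exists>k::int. 2 * pi * x / of_int N = 2 * pi * x' / of_int N + of_int (2 * k) * pi)"
    unfolding cyl_def exp_eq by (subst complex_eq_iff) simp
  ultimately show ?thesis by simp
qed

text \<open>The image of a straight segment of the universal cover is injective because its height
  strictly increases.\<close>

lemma arc_cyl:
  assumes "N > 0"
  shows "arc (\<lambda>s. cyl N (y + s) ((1 - s) * b + s * t))"
proof -
  have "continuous_on {0..1} (\<lambda>s. cyl N (y + s) ((1 - s) * b + s * t))"
    unfolding cyl_def Complex_eq by (intro continuous_intros) (use assms in auto)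
  moreover have "inj_on (\<lambda>s. cyl N (y + s) ((1 - s) * b + s * t)) {0..1}"
    by (rule inj_onI) (simp add: cyl_eq_iff[OF assms])
  ultimately show ?thesis by (simp add: arc_def path_def)
qed

text \<open>The horizontal distance at parameter \<open>s\<close> is a convex combination of the
  distances at the two ends, which never have opposite signs; it vanishes only if each weighted term
  does.\<close>

lemma segments_meet:
  fixes b t b' t' s :: real
  assumes "0 \<le> s" "s \<le> 1" "(1 - s) * b + s * t = (1 - s) * b' + s * t'"
    and "b < b' \<Longrightarrow> t \<le> t'" "b' < b \<Longrightarrow> t' \<le> t"
  shows "s = 0 \<and> b = b' \<or> s = 1 \<and> t = t' \<or> b = b' \<and> t = t'"
proof -
  have *: "s = 1 \<and> t = t'"
    if "(1 - s) * b + s * t = (1 - s) * b' + s * t'" "b < b'" "t \<le> t'" for b t b' t' :: real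
  proof -
    have "(1 - s) * (b' - b) + s * (t' - t) = 0" using that(1) by (simp add: algebra_simps)
    moreover have "(1 - s) * (b' - b) \<ge> 0" "s * (t' - t) \<ge> 0" using that assms(1,2) by auto
    ultimately have "(1 - s) * (b' - b) = 0" "s * (t' - t) = 0" by linarith+
    thus ?thesis using that by auto
  qed
  consider "b < b'" | "b' < b" | "b = b'" by linarith
  thus ?thesis
  proof cases
    case 3
    hence "s * (t - t') = 0" using assms(3) by (simp add: algebra_simps)
    thus ?thesis using 3 by auto
  qed (use *[of b t b' t'] *[of b' t' b t] assms(3-5) in auto)
qed

text \<open>
  The members of \<open>S y\<close> are the (bottom, top) abscissae, in the universal cover of the cylinder, of
  edges between rows \<open>y\<close> and \<open>y + 1\<close>.
\<close>

lemma planar_layered_cylinder: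
  fixes row :: "'a \<Rightarrow> nat" and X :: "'a \<Rightarrow> int"
  assumes N: "N > 0"
    and inj: "\<And>u v. u \<in> A \<Longrightarrow> v \<in> A \<Longrightarrow> row u = row v \<Longrightarrow> X u mod N = X v mod N \<Longrightarrow> u = v"
    and F: "\<And>u v. (u, v) \<in> F \<Longrightarrow> u \<in> A \<and> v \<in> A \<and> row v = Suc (row u)"
    and lift: "\<And>u v. (u, v) \<in> F \<Longrightarrow>
      \<exists>b t. b mod N = X u mod N \<and> t mod N = X v mod N \<and> (b, t) \<in> S (row u)"
    and per: "\<And>b t k y. (b, t) \<in> S y \<Longrightarrow> (b + N * k, t + N * k) \<in> S y"
    and mono: "\<And>b t b' t' y. (b, t) \<in> S y \<Longrightarrow> (b', t') \<in> S y \<Longrightarrow> b < b' \<Longrightarrow> t \<le> t'"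
  shows "planar A {{u, v} | u v. (u, v) \<in> F}"
proof -
  obtain b t where bt: "\<And>u v. (u, v) \<in> F \<Longrightarrow>
      b u v mod N = X u mod N \<and> t u v mod N = X v mod N \<and> (b u v, t u v) \<in> S (row u)"
    using lift by metis
  define p where "p v = cyl N (real (row v)) (real_of_int (X v))" for v
  define g where "g u v s = cyl N (real (row u) + s) ((1 - s) * real_of_int (b u v) + s * real_of_int (t u v))"
    for u v and s :: real
  have mod_iff: "(\<exists>k. real_of_int x = real_of_int x' + of_int (N * k)) \<longleftrightarrow> x mod N = x' mod N" for x x'
  proof -
    have "(\<exists>k. real_of_int x = real_of_int x' + of_int (N * k)) \<longleftrightarrow> (\<exists>k. x = x' + N * k)"
      by (metis of_int_add of_int_eq_iff)
    also have "\<dots> \<longleftrightarrow> x mod N = x' mod N"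
      by (metis add.commute mod_eqE mod_mult_self2 mult.commute)
    finally show ?thesis .
  qed
  have p_eq: "cyl N (real y) (real_of_int x) = p v \<longleftrightarrow> y = row v \<and> x mod N = X v mod N" for y x v
    using mod_iff by (simp add: p_def cyl_eq_iff[OF N])
  have p_inj: "p u = p v \<longleftrightarrow> u = v" if "u \<in> A" "v \<in> A" for u v
    using that inj[of u v] p_eq[of "row u" "X u" v] by (auto simp: p_def)
  have g0: "g u v 0 = p u" and g1: "g u v 1 = p v" if "(u, v) \<in> F" for u v
  proof -
    show "g u v 0 = p u" using bt[OF that] p_eq[of "row u" "b u v" u] by (simp add: g_def)
    have "g u v 1 = cyl N (real (row v)) (real_of_int (t u v))"
      using F[OF that] by (simp add: g_def add.commute)
    thus "g u v 1 = p v" using bt[OF that] p_eq[of "row v" "t u v" v] by simp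
  qed
  \<comment> \<open>Vertices have integer heights, so an edge spanning one row step can meet them
    only at its ends.\<close>
  have row_g: "row w = row u \<and> s = 0 \<or> row w = Suc (row u) \<and> s = 1"
    if "g u v s = p w" "s \<in> {0..1}" for u v s w
  proof -
    have "real (row u) + s = real (row w)"
      using that(1) by (simp add: g_def p_def cyl_eq_iff[OF N])
    moreover from this have "row u \<le> row w" "row w \<le> Suc (row u)" using that(2) by auto
    ultimately show ?thesis by (auto simp: le_Suc_eq)
  qed
  \<comment> \<open>Edges are unordered sets; their orientation is recovered by choice, and it is
    unique since rows increase along \<open>F\<close>.\<close>
  define \<gamma> where "\<gamma> e = (case (SOME uv. uv \<in> F \<and> e = {fst uv, snd uv}) of (u, v) \<Rightarrow> g u v)" for e
  have \<gamma>: "\<gamma> {u, v} = g u v" if "(u, v) \<in> F" for u v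
  proof -
    have "(SOME uv. uv \<in> F \<and> {u, v} = {fst uv, snd uv}) = (u, v)"
    proof (rule some_equality)
      fix uv assume *: "uv \<in> F \<and> {u, v} = {fst uv, snd uv}"
      obtain u' v' where uv: "uv = (u', v')" by (cases uv)
      have "row v' = Suc (row u')" "row v = Suc (row u)"
        using F[of u' v'] F[OF that] * uv by simp_all
      moreover have "u = u' \<and> v = v' \<or> u = v' \<and> v = u'"
        using * uv by (simp add: doubleton_eq_iff)
      ultimately show "uv = (u, v)" using uv by auto
    qed (use that in simp)
    thus ?thesis by (simp add: \<gamma>_def)
  qed
  have cross: "s \<in> {0, 1} \<or> (u, v) = (u', v')"
    if e: "(u, v) \<in> F" "(u', v') \<in> F" and s: "s \<in> {0..1}" "s' \<in> {0..1}" "g u v s = g u' v' s'"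
    for u v u' v' s s'
  proof (rule disjCI)
    assume ne: "(u, v) \<noteq> (u', v')"
    show "s \<in> {0, 1}"
    proof (rule ccontr)
      assume "s \<notin> {0, 1}"
      hence s01: "0 < s" "s < 1" using s by auto
      obtain k where rw: "real (row u) + s = real (row u') + s'" and
        k: "(1 - s) * real_of_int (b u v) + s * real_of_int (t u v) =
            (1 - s') * real_of_int (b u' v') + s' * real_of_int (t u' v') + of_int (N * k)"
        using s(3) by (auto simp: g_def cyl_eq_iff[OF N])
      have rr: "row u = row u'" "s = s'"
      proof -
        have "\<bar>real (row u) - real (row u')\<bar> < 1" using rw s(2) s01 by auto
        thus "row u = row u'" by linarith
        thus "s = s'" using rw by simp
      qed
      \<comment> \<open>The second lift is moved by \<open>k\<close> periods, so that the two
        segments meet already in the universal cover.\<close>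
      define b' t' where bt': "b' = b u' v' + N * k" "t' = t u' v' + N * k"
      have S: "(b u v, t u v) \<in> S (row u)" "(b', t') \<in> S (row u)"
        using bt[OF e(1)] bt[OF e(2)] per[of "b u' v'" "t u' v'" "row u'" k] rr by (simp_all add: bt')
      have eq: "(1 - s) * real_of_int (b u v) + s * real_of_int (t u v) =
            (1 - s) * real_of_int b' + s * real_of_int t'"
        using k rr by (simp add: bt' algebra_simps)
      have "b u v = b' \<and> t u v = t'"
        using segments_meet[OF _ _ eq] s01 mono[OF S] mono[OF S(2,1)] by simp
      hence "X u mod N = X u' mod N" "X v mod N = X v' mod N"
        using bt[OF e(1)] bt[OF e(2)] by (auto simp: bt')
      hence "u = u'" "v = v'" using inj[of u u'] inj[of v v'] F[OF e(1)] F[OF e(2)] rr by simp_all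
      thus False using ne by simp
    qed
  qed
  have "plane_drawing A {{u, v} | u v. (u, v) \<in> F} p \<gamma>"
    unfolding plane_drawing_def
  proof (intro conjI ballI impI)
    show "inj_on p A" using p_inj by (auto simp: inj_on_def)
  next
    fix e assume "e \<in> {{u, v} | u v. (u, v) \<in> F}"
    then obtain u v where uv: "e = {u, v}" "(u, v) \<in> F" by blast
    show "arc (\<gamma> e)" using arc_cyl[OF N] by (simp add: uv \<gamma> g_def[abs_def])
    show ends: "{pathstart (\<gamma> e), pathfinish (\<gamma> e)} = p ` e"
      using g0 g1 uv by (simp add: \<gamma> pathstart_def pathfinish_def)
    have "z \<in> p ` e" if z: "z \<in> path_image (\<gamma> e)" "z \<in> p ` A" for z
    proof -
      obtain s w where s: "s \<in> {0..1}" "z = g u v s" "w \<in> A" "z = p w"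
        using z uv by (auto simp: \<gamma> path_image_def)
      hence "s = 0 \<or> s = 1" using row_g[of u v s w] by auto
      thus ?thesis using s g0 g1 uv by auto
    qed
    moreover have "p ` e \<subseteq> path_image (\<gamma> e)"
      unfolding ends[symmetric]
      using pathstart_in_path_image[of "\<gamma> e"] pathfinish_in_path_image[of "\<gamma> e"] by simp
    moreover have "p ` e \<subseteq> p ` A" using uv F[OF uv(2)] by auto
    ultimately show "path_image (\<gamma> e) \<inter> p ` A = p ` e" by blast
  next
    fix e f assume "e \<in> {{u, v} | u v. (u, v) \<in> F}" "f \<in> {{u, v} | u v. (u, v) \<in> F}" and ne: "e \<noteq> f"
    then obtain u v u' v' where uv: "e = {u, v}" "(u, v) \<in> F" "f = {u', v'}" "(u', v') \<in> F" by blast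
    have A: "u \<in> A" "v \<in> A" "u' \<in> A" "v' \<in> A" using F[OF uv(2)] F[OF uv(4)] by simp_all
    show "path_image (\<gamma> e) \<inter> path_image (\<gamma> f) \<subseteq> p ` (e \<inter> f)"
    proof
      fix z assume "z \<in> path_image (\<gamma> e) \<inter> path_image (\<gamma> f)"
      then obtain s s' where s: "s \<in> {0..1}" "s' \<in> {0..1}" "z = g u v s" "z = g u' v' s'"
        using uv by (auto simp: \<gamma> path_image_def)
      have "s \<in> {0, 1}" "s' \<in> {0, 1}"
        using cross[OF uv(2,4) s(1,2)] cross[OF uv(4,2) s(2,1)] s ne uv by auto
      hence "z \<in> p ` e" "z \<in> p ` f" using s g0 g1 uv by auto
      thus "z \<in> p ` (e \<inter> f)" using uv A p_inj by auto
    qed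
  qed
  thus ?thesis unfolding planar_def by blast
qed

lemma planar_mono: "planar A E \<Longrightarrow> E' \<subseteq> E \<Longrightarrow> planar A E'"
  unfolding planar_def plane_drawing_def by (meson subsetD)

section \<open>The two glued grids\<close>

text \<open>
  A vertex is a pair of a row and a column. For \<open>y < n - 1\<close>, the vertex \<open>(y, c)\<close> is the arc
  \<open>{c, \<dots>, c + y}\<close> of \<open>\<int>/n\<close>; row \<open>n - 1\<close> consists of the elements \<open>b\<close>, in column \<open>i + 1\<close> for \<open>b i\<close>,
  and of \<open>x = (n - 1, n)\<close>. The second copy is the mirror image in the rows \<open>n, \<dots>, 2 * n - 1\<close>.
\<close>

definition verts :: "nat \<Rightarrow> (nat \<times> nat) set" where
  "verts n = {..<2 * n} \<times> {..<n} \<union> {(n - 1, n), (n, n)}"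

text \<open>Exchanges the two copies and swaps \<open>x\<close> with \<open>x' = (n, n)\<close>. It
  reverses the rows of the drawing but preserves the direction of the order.\<close>

definition mirror :: "nat \<Rightarrow> nat \<times> nat \<Rightarrow> nat \<times> nat" where
  "mirror n = (\<lambda>(y, c). (2 * n - 1 - y, c))"

text \<open>Extending an arc to the right keeps its column, extending it to the left lowers the
  column by one. Left extensions stop below row \<open>n - 1\<close>, as each \<open>b i\<close>
  covers a single arc. The last set is the glue from \<open>x\<close> to all
  \<open>b'\<close>.\<close>

definition half_arcs :: "nat \<Rightarrow> ((nat \<times> nat) \<times> (nat \<times> nat)) set" where
  "half_arcs n =
     {((y, c), (Suc y, c)) | y c. Suc y < n \<and> c < n} \<union>
     {((y, Suc c mod n), (Suc y, c)) | y c. Suc (Suc y) < n \<and> c < n} \<union>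
     {((n - 2, 0), (n - 1, n)), ((n - 2, 1), (n - 1, n))} \<union>
     {((n - 1, n), (n, c)) | c. c < n}"

definition arcs :: "nat \<Rightarrow> ((nat \<times> nat) \<times> (nat \<times> nat)) set" where
  "arcs n = half_arcs n \<union> (\<lambda>(u, v). (mirror n u, mirror n v)) ` half_arcs n"

text \<open>The minimum folds the second copy onto the first. Although \<open>x\<close> and the
  \<open>b\<close> share a row, the \<open>b\<close> get a higher level: they lie above
  \<open>x'\<close>, whose level is that of \<open>x\<close>.\<close>

definition level :: "nat \<Rightarrow> nat \<times> nat \<Rightarrow> nat" where
  "level n = (\<lambda>(y, c). let z = min y (2 * n - 1 - y) in
     if z < n - 1 then Suc z else if c = n then n else Suc n)"

lemma half_arcs_cases:
  assumes "(u, v) \<in> half_arcs n"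
  obtains (col) y c where "u = (y, c)" "v = (Suc y, c)" "Suc y < n" "c < n"
  | (diag) y c where "u = (y, Suc c mod n)" "v = (Suc y, c)" "Suc (Suc y) < n" "c < n"
  | (apex) c where "u = (n - 2, c)" "v = (n - 1, n)" "c = 0 \<or> c = 1"
  | (fan) c where "u = (n - 1, n)" "v = (n, c)" "c < n"
  using assms unfolding half_arcs_def by blast

lemma half_arcsI:
  "Suc y < n \<Longrightarrow> c < n \<Longrightarrow> ((y, c), (Suc y, c)) \<in> half_arcs n"
  "Suc (Suc y) < n \<Longrightarrow> c < n \<Longrightarrow> ((y, Suc c mod n), (Suc y, c)) \<in> half_arcs n"
  "((n - 2, 0), (n - 1, n)) \<in> half_arcs n"
  "((n - 2, 1), (n - 1, n)) \<in> half_arcs n"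
  "c < n \<Longrightarrow> ((n - 1, n), (n, c)) \<in> half_arcs n"
  unfolding half_arcs_def by blast+

lemma finite_verts: "finite (verts n)"
  by (simp add: verts_def)

lemma half_arcs_verts:
  assumes "2 \<le> n" "(u, v) \<in> half_arcs n" shows "u \<in> verts n \<and> v \<in> verts n"
  using assms(2) by (cases rule: half_arcs_cases) (use assms(1) in \<open>auto simp: verts_def\<close>)

lemma mirror_verts: "2 \<le> n \<Longrightarrow> u \<in> verts n \<Longrightarrow> mirror n u \<in> verts n"
  by (auto simp: verts_def mirror_def)

lemma mirror_mirror: "2 \<le> n \<Longrightarrow> u \<in> verts n \<Longrightarrow> mirror n (mirror n u) = u"
  by (auto simp: verts_def mirror_def)

lemma level_mirror: "2 \<le> n \<Longrightarrow> u \<in> verts n \<Longrightarrow> level n (mirror n u) = level n u"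
  by (auto simp: verts_def mirror_def level_def Let_def min_def)

lemma level_half_arcs:
  assumes n: "2 \<le> n" and uv: "(u, v) \<in> half_arcs n" shows "level n u < level n v"
  using uv by (cases rule: half_arcs_cases) (use n in \<open>auto simp: level_def Let_def min_def\<close>)

lemma arcs_cases:
  assumes "(u, v) \<in> arcs n"
  obtains "(u, v) \<in> half_arcs n"
  | u' v' where "(u', v') \<in> half_arcs n" "u = mirror n u'" "v = mirror n v'"
  using assms unfolding arcs_def by auto

lemma arcs_verts: "2 \<le> n \<Longrightarrow> arcs n \<subseteq> verts n \<times> verts n"
  using half_arcs_verts mirror_verts by (auto elim!: arcs_cases)

lemma level_arcs:
  assumes n: "2 \<le> n" and uv: "(u, v) \<in> arcs n" shows "level n u < level n v"
  using uv
proof (cases rule: arcs_cases)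
  case (2 u' v')
  thus ?thesis using level_half_arcs[OF n 2(1)] half_arcs_verts[OF n 2(1)] level_mirror[OF n] by simp
qed (use level_half_arcs[OF n] in blast)

lemma level_verts: "2 \<le> n \<Longrightarrow> u \<in> verts n \<Longrightarrow> 1 \<le> level n u \<and> level n u \<le> Suc n"
  by (auto simp: verts_def level_def Let_def min_def)

text \<open>\<open>mirror\<close> is an involution on the vertices and so swaps the two halves of
  \<open>arcs n\<close>; reachability facts transfer between the copies.\<close>

lemma arcs_mirror:
  assumes n: "2 \<le> n" and uv: "(u, v) \<in> arcs n" shows "(mirror n u, mirror n v) \<in> arcs n"
  using uv
proof (cases rule: arcs_cases)
  case 1
  thus ?thesis unfolding arcs_def by force
next
  case (2 u' v')
  thus ?thesis using half_arcs_verts[OF n 2(1)] mirror_mirror[OF n] by (simp add: arcs_def)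
qed

lemma rtrancl_arcs_mirror:
  assumes n: "2 \<le> n" and uv: "(u, v) \<in> (arcs n)\<^sup>*" shows "(mirror n u, mirror n v) \<in> (arcs n)\<^sup>*"
  using uv
proof induction
  case (step v w)
  thus ?case using arcs_mirror[OF n step.hyps(2)] by (meson rtrancl.rtrancl_into_rtrancl)
qed simp

section \<open>Reachability in the glued grids\<close>

lemma half_arcs_arcs: "e \<in> half_arcs n \<Longrightarrow> e \<in> arcs n"
  by (simp add: arcs_def)

lemma arcs_column:
  "c < n \<Longrightarrow> y + d < n \<Longrightarrow> ((y, c), (y + d, c)) \<in> (arcs n)\<^sup>*"
proof (induction d)
  case (Suc d)
  have "((y + d, c), (y + Suc d, c)) \<in> arcs n"
    using half_arcsI(1)[of "y + d" n c] Suc.prems by (simp add: half_arcs_arcs)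
  moreover have "((y, c), (y + d, c)) \<in> (arcs n)\<^sup>*" using Suc by simp
  ultimately show ?case by (rule rtrancl_into_rtrancl[rotated])
qed simp

lemma arcs_diagonal:
  "c < n \<Longrightarrow> Suc d < n \<Longrightarrow> ((0, (c + d) mod n), (d, c)) \<in> (arcs n)\<^sup>*"
proof (induction d arbitrary: c)
  case (Suc d)
  have "((0, (Suc c mod n + d) mod n), (d, Suc c mod n)) \<in> (arcs n)\<^sup>*"
    using Suc by simp
  moreover have "((d, Suc c mod n), (Suc d, c)) \<in> arcs n"
    using half_arcsI(2)[of d n c] Suc.prems by (simp add: half_arcs_arcs)
  moreover have "(Suc c mod n + d) mod n = (c + Suc d) mod n"
    by (simp add: mod_simps)
  ultimately show ?case by (metis rtrancl.rtrancl_into_rtrancl)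
qed simp

text \<open>The singleton at \<open>c + d\<close> is first extended to the left as far as
  \<open>c\<close>, then to the right.\<close>

lemma arcs_reach:
  assumes "c < n" "d \<le> y" "y < n" "Suc d < n"
  shows "((0, (c + d) mod n), (y, c)) \<in> (arcs n)\<^sup>*"
  using arcs_diagonal[of c n d] arcs_column[of c n d "y - d"] assms by (simp add: rtrancl_trans)

lemma arcs_reach_top:
  assumes n: "2 \<le> n" and ij: "i < n" "j < n" "i \<noteq> j"
  shows "((0, i), (n - 1, Suc j mod n)) \<in> (arcs n)\<^sup>*"
proof -
  define c where "c = Suc j mod n"
  \<comment> \<open>The cyclic offset of \<open>i\<close> from column \<open>c\<close>; adding
    \<open>n\<close> first avoids truncated subtraction. The offset \<open>n - 1\<close> would mean
    \<open>i = j\<close>.\<close>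
  define d where "d = (i + n - c) mod n"
  have c: "c < n" and d: "d < n" using n by (simp_all add: c_def d_def)
  have i: "i = (c + d) mod n"
    using c ij by (simp add: d_def mod_simps)
  have "d \<noteq> n - 1"
  proof
    assume "d = n - 1"
    hence "i = (Suc j + (n - 1)) mod n" using i by (simp add: c_def mod_simps)
    also have "\<dots> = j" using n ij by simp
    finally show False using ij by simp
  qed
  hence "Suc d < n" using d by simp
  thus ?thesis using arcs_reach[of c n d "n - 1"] c i by (simp add: c_def)
qed

text \<open>The two arcs below \<open>x\<close> omit only \<open>n - 1\<close> and only
  \<open>0\<close>, so together they contain every point.\<close>

lemma arcs_reach_apex:
  assumes n: "2 \<le> n" and i: "i < n"
  shows "((0, i), (n - 1, n)) \<in> (arcs n)\<^sup>*"
proof (cases "i < n - 1")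
  case True
  have "((0, i), (n - 2, 0)) \<in> (arcs n)\<^sup>*"
    using arcs_reach[of 0 n i "n - 2"] n True by simp
  thus ?thesis using half_arcs_arcs[OF half_arcsI(3)] by (meson rtrancl.rtrancl_into_rtrancl)
next
  case False
  hence "i = (1 + (n - 2)) mod n" using n i by simp
  hence "((0, i), (n - 2, 1)) \<in> (arcs n)\<^sup>*"
    using arcs_reach[of 1 n "n - 2" "n - 2"] n by simp
  thus ?thesis using half_arcs_arcs[OF half_arcsI(4)] by (meson rtrancl.rtrancl_into_rtrancl)
qed

lemma arcs_reach_other:
  assumes n: "2 \<le> n" and i: "i < n" and j: "j < n"
  shows "((0, i), (n, j)) \<in> (arcs n)\<^sup>*"
  using arcs_reach_apex[OF n i] half_arcs_arcs[OF half_arcsI(5)[OF j]]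
  by (meson rtrancl.rtrancl_into_rtrancl)

lemma arcs_not_reach:
  assumes n: "2 \<le> n" and i: "i < n"
  shows "((0, i), (n - 1, Suc i mod n)) \<notin> (arcs n)\<^sup>*"
proof
  \<comment> \<open>A set closed under arcs: the arcs containing \<open>i\<close>, row
    \<open>n - 1\<close> without \<open>b i\<close>, and all \<open>b'\<close>. Leaving out
    \<open>x'\<close> is essential, since it lies below \<open>b i\<close>.\<close>
  define M where "M = {(y, c). Suc y < n \<and> c < n \<and> (\<exists>d\<le>y. i = (c + d) mod n)} \<union>
    {(n - 1, c) | c. c \<noteq> Suc i mod n} \<union> {(n, c) | c. c < n}"
  have ne: "n \<noteq> Suc i mod n" using mod_less_divisor[of n "Suc i"] n by linarith
  have closed: "v \<in> M" if u: "u \<in> M" and uv: "(u, v) \<in> arcs n" for u v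
    using uv
  proof (cases rule: arcs_cases)
    case 1
    thus ?thesis
    proof (cases rule: half_arcs_cases)
      case (col y c)
      then obtain d where d: "d \<le> y" "i = (c + d) mod n"
        using u by (auto simp: M_def)
      show ?thesis
      proof (cases "Suc (Suc y) < n")
        case True
        thus ?thesis using col d by (auto simp: M_def intro: le_SucI)
      next
        case False
        hence y: "Suc y = n - 1" using col by simp
        \<comment> \<open>The arc of \<open>n - 1\<close> points starting right after
          \<open>i\<close> is the one that misses \<open>i\<close>.\<close>
        have "c \<noteq> Suc i mod n"
        proof
          assume "c = Suc i mod n"
          moreover have "Suc i mod n = (c + Suc d) mod n" using d(2) by (simp add: mod_simps)
          ultimately have "c mod n = (c + Suc d) mod n" using col(4) by (metis mod_less)
          hence "n dvd Suc d" by (metis mod_eq_dvd_iff_nat add_diff_cancel_left' le_add1)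
          thus False using d y col by (auto dest: dvd_imp_le)
        qed
        thus ?thesis using col y by (simp add: M_def)
      qed
    next
      case (diag y c)
      then obtain d where "d \<le> y" "i = (Suc c mod n + d) mod n"
        using u by (auto simp: M_def)
      hence "Suc d \<le> Suc y \<and> i = (c + Suc d) mod n" by (simp add: mod_simps)
      thus ?thesis using diag by (auto simp: M_def)
    next
      case (apex c)
      thus ?thesis using n ne by (auto simp: M_def)
    next
      case (fan c)
      thus ?thesis by (simp add: M_def)
    qed
  next
    case (2 u' v')
    \<comment> \<open>No mirrored arc starts in \<open>M\<close>: its source is \<open>x'\<close> or
      lies in a row above \<open>n\<close>.\<close>
    from 2(1) show ?thesis
      by (cases rule: half_arcs_cases) (use 2(2,3) u n in \<open>auto simp: M_def mirror_def\<close>)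
  qed
  have "v \<in> M" if "((0, i), v) \<in> (arcs n)\<^sup>*" for v
    using that
  proof induction
    case base
    show ?case using n i by (auto simp: M_def)
  qed (use closed in blast)
  moreover assume "((0, i), (n - 1, Suc i mod n)) \<in> (arcs n)\<^sup>*"
  ultimately have "(n - 1, Suc i mod n) \<in> M" by blast
  thus False using n by (auto simp: M_def)
qed

section \<open>Planarity of the glued grids\<close>

text \<open>
  The cylinder has circumference \<open>2 * n\<close>. Abscissae are doubled so that \<open>x\<close> and \<open>x'\<close> fit, at abscissa 1,
  between the columns 0 and 1.
\<close>

definition abscissa :: "nat \<Rightarrow> nat \<times> nat \<Rightarrow> int" where
  "abscissa n = (\<lambda>(y, c). if c = n then 1 else 2 * int c)"

text \<open>In the universal cover every diagonal goes from \<open>2 * m\<close> to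
  \<open>2 * m - 2\<close>, so the wrap between columns \<open>0\<close> and \<open>n - 1\<close> is
  no special case. The lifts of \<open>x\<close> are the points
  \<open>2 * int n * k + 1\<close>.\<close>

definition low_lifts :: "nat \<Rightarrow> nat \<Rightarrow> (int \<times> int) set" where
  "low_lifts n y = {(2 * m, 2 * m) | m. True} \<union>
     (if Suc (Suc y) < n then {(2 * m, 2 * m - 2) | m. True}
      else {(2 * int n * k, 2 * int n * k + 1) | k. True} \<union> {(2 * int n * k + 2, 2 * int n * k + 1) | k. True})"

text \<open>The two fans in the middle strip avoid crossing by going opposite ways round:
  \<open>x\<close> is joined to the \<open>b'\<close> of the period to its right, \<open>x'\<close>
  to the \<open>b\<close> of the period to its left.\<close>

definition mid_lifts :: "nat \<Rightarrow> (int \<times> int) set" where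
  "mid_lifts n =
     {(2 * int n * k + 1, 2 * m) | k m. 2 * int n * k + 1 < 2 * m \<and> 2 * m < 2 * int n * k + 2 * int n + 1} \<union>
     {(2 * m, 2 * int n * k + 1) | k m. 2 * int n * k - 2 * int n + 1 < 2 * m \<and> 2 * m < 2 * int n * k + 1}"

text \<open>Reflection takes the strip above row \<open>y\<close> to the strip above row
  \<open>2 * n - 2 - y\<close> and swaps bottom and top.\<close>

definition lifts :: "nat \<Rightarrow> nat \<Rightarrow> (int \<times> int) set" where
  "lifts n y = (if Suc y < n then low_lifts n y else if Suc y = n then mid_lifts n
     else (low_lifts n (2 * n - 2 - y))\<inverse>)"

text \<open>Stated with whole products, which linear arithmetic can treat as atoms.\<close>

lemma multiple_trichotomy:
  fixes N k k' :: int
  assumes "N \<ge> 0"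
  shows "N * k = N * k' \<or> N * k + N \<le> N * k' \<or> N * k' + N \<le> N * k"
proof -
  have "N * k + N \<le> N * k'" if "k < k'" for k k'
    using mult_left_mono[of "k + 1" k' N] that assms by (simp add: algebra_simps)
  thus ?thesis by (metis linorder_neqE)
qed

lemma low_lifts_mono:
  assumes n: "2 \<le> n" and bt: "(b, t) \<in> low_lifts n y" "(b', t') \<in> low_lifts n y" and less: "b < b'"
  shows "t \<le> t'"
proof (cases "Suc (Suc y) < n")
  case True
  thus ?thesis using bt less by (auto simp: low_lifts_def)
next
  case False
  define N where "N = 2 * int n"
  have N: "N \<ge> 4" using n by (simp add: N_def)
  have shape: "(\<exists>m. b = 2 * m \<and> t = 2 * m) \<or> (\<exists>k. b \<in> {N * k, N * k + 2} \<and> t = N * k + 1)"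
    if "(b, t) \<in> low_lifts n y" for b t
    using that False by (auto simp: low_lifts_def N_def)
  \<comment> \<open>Distinct column abscissae differ by at least 2, so \<open>N * k + 1\<close> fits
    strictly between neighbouring columns.\<close>
  have even: "\<exists>j. N * k = 2 * j" for k by (rule exI[of _ "int n * k"]) (simp add: N_def)
  from shape[OF bt(1)] shape[OF bt(2)] show ?thesis
  proof (elim disjE exE conjE)
    fix k k' assume "t = N * k + 1" "t' = N * k' + 1" "b \<in> {N * k, N * k + 2}" "b' \<in> {N * k', N * k' + 2}"
    hence "t = N * k + 1" "t' = N * k' + 1" "N * k \<le> b" "b' \<le> N * k' + 2" by auto
    thus ?thesis using less N multiple_trichotomy[of N k k'] by linarith
  next
    fix m k assume "b = 2 * m" "t = 2 * m" "t' = N * k + 1" "b' \<in> {N * k, N * k + 2}"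
    thus ?thesis using less even[of k] by auto
  next
    fix k m assume "t = N * k + 1" "b \<in> {N * k, N * k + 2}" "b' = 2 * m" "t' = 2 * m"
    thus ?thesis using less even[of k] by auto
  qed (use less in auto)
qed

lemma mid_lifts_mono:
  assumes bt: "(b, t) \<in> mid_lifts n" "(b', t') \<in> mid_lifts n" and less: "b < b'"
  shows "t \<le> t'"
proof -
  define N where "N = 2 * int n"
  have N: "N \<ge> 0" by (simp add: N_def)
  have shape: "(\<exists>k. b = N * k + 1 \<and> N * k + 1 < t \<and> t < N * k + N + 1) \<or>
      (\<exists>k. t = N * k + 1 \<and> N * k - N + 1 < b \<and> b < N * k + 1)"
    if "(b, t) \<in> mid_lifts n" for b t
    using that by (auto simp: mid_lifts_def N_def)
  from shape[OF bt(1)] shape[OF bt(2)] show ?thesis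
  proof (elim disjE exE conjE)
    fix k k' assume "b = N * k + 1" "t < N * k + N + 1" "b' = N * k' + 1" "N * k' + 1 < t'"
    thus ?thesis using less N multiple_trichotomy[of N k k'] by linarith
  next
    fix k k' assume "b = N * k + 1" "t < N * k + N + 1" "t' = N * k' + 1" "b' < N * k' + 1"
    thus ?thesis using less N multiple_trichotomy[of N k k'] by linarith
  next
    fix k k' assume "t = N * k + 1" "N * k - N + 1 < b" "b' = N * k' + 1" "N * k' + 1 < t'"
    thus ?thesis using less N multiple_trichotomy[of N k k'] by linarith
  next
    fix k k' assume "t = N * k + 1" "N * k - N + 1 < b" "t' = N * k' + 1" "b' < N * k' + 1"
    thus ?thesis using less N multiple_trichotomy[of N k k'] by linarith
  qed
qed

lemma lifts_mono:
  assumes n: "2 \<le> n" and bt: "(b, t) \<in> lifts n y" "(b', t') \<in> lifts n y" and less: "b < b'"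
  shows "t \<le> t'"
proof -
  consider "Suc y < n" | "Suc y = n" | "n < Suc y" by linarith
  thus ?thesis
  proof cases
    case 1 thus ?thesis using low_lifts_mono[OF n] bt less by (simp add: lifts_def)
  next
    case 2 thus ?thesis using mid_lifts_mono bt less by (simp add: lifts_def)
  next
    case 3
    hence "(t, b) \<in> low_lifts n (2 * n - 2 - y)" "(t', b') \<in> low_lifts n (2 * n - 2 - y)"
      using bt by (auto simp: lifts_def)
    \<comment> \<open>Monotonicity passes to the converse by contraposition: \<open>t' < t\<close>
      would give \<open>b' \<le> b\<close>.\<close>
    thus ?thesis using low_lifts_mono[OF n, of t' b' _ t b] less by (meson leD leI)
  qed
qed

lemma low_liftsI:
  "(2 * m, 2 * m) \<in> low_lifts n y"
  "Suc (Suc y) < n \<Longrightarrow> (2 * m, 2 * m - 2) \<in> low_lifts n y"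
  "\<not> Suc (Suc y) < n \<Longrightarrow> (2 * int n * k, 2 * int n * k + 1) \<in> low_lifts n y"
  "\<not> Suc (Suc y) < n \<Longrightarrow> (2 * int n * k + 2, 2 * int n * k + 1) \<in> low_lifts n y"
  unfolding low_lifts_def by auto

lemma low_lifts_translate:
  assumes "(b, t) \<in> low_lifts n y"
  shows "(b + 2 * int n * k, t + 2 * int n * k) \<in> low_lifts n y"
proof -
  let ?N = "2 * int n"
  consider (a) m where "b = 2 * m" "t = 2 * m"
    | (b) m where "Suc (Suc y) < n" "b = 2 * m" "t = 2 * m - 2"
    | (c) l where "\<not> Suc (Suc y) < n" "b = ?N * l" "t = ?N * l + 1"
    | (d) l where "\<not> Suc (Suc y) < n" "b = ?N * l + 2" "t = ?N * l + 1"
    using assms by (auto simp: low_lifts_def split: if_splits)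
  thus ?thesis
  proof cases
    case a
    hence "b + ?N * k = 2 * (m + int n * k)" "t + ?N * k = 2 * (m + int n * k)"
      by (simp_all add: algebra_simps)
    thus ?thesis by (simp only: low_liftsI)
  next
    case b
    hence "b + ?N * k = 2 * (m + int n * k)" "t + ?N * k = 2 * (m + int n * k) - 2"
      by (simp_all add: algebra_simps)
    thus ?thesis using b(1) by (simp only: low_liftsI not_False_eq_True)
  next
    case c
    hence "b + ?N * k = ?N * (l + k)" "t + ?N * k = ?N * (l + k) + 1"
      by (simp_all add: algebra_simps)
    thus ?thesis using c(1) by (simp only: low_liftsI not_False_eq_True)
  next
    case d
    hence "b + ?N * k = ?N * (l + k) + 2" "t + ?N * k = ?N * (l + k) + 1"
      by (simp_all add: algebra_simps)
    thus ?thesis using d(1) by (simp only: low_liftsI not_False_eq_True)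
  qed
qed

lemma mid_lifts_translate:
  assumes "(b, t) \<in> mid_lifts n"
  shows "(b + 2 * int n * k, t + 2 * int n * k) \<in> mid_lifts n"
proof -
  let ?N = "2 * int n"
  obtain l m where lm:
    "b = ?N * l + 1 \<and> t = 2 * m \<and> ?N * l + 1 < 2 * m \<and> 2 * m < ?N * l + ?N + 1 \<or>
     b = 2 * m \<and> t = ?N * l + 1 \<and> ?N * l - ?N + 1 < 2 * m \<and> 2 * m < ?N * l + 1"
    using assms unfolding mid_lifts_def by blast
  define l' m' where l'm': "l' = l + k" "m' = m + int n * k"
  have "?N * l' = ?N * l + ?N * k" "2 * m' = 2 * m + ?N * k"
    by (simp_all add: l'm' algebra_simps)
  with lm have "b + ?N * k = ?N * l' + 1 \<and> t + ?N * k = 2 * m' \<and> ?N * l' + 1 < 2 * m' \<and> 2 * m' < ?N * l' + ?N + 1 \<or>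
     b + ?N * k = 2 * m' \<and> t + ?N * k = ?N * l' + 1 \<and> ?N * l' - ?N + 1 < 2 * m' \<and> 2 * m' < ?N * l' + 1"
    by auto
  thus ?thesis unfolding mid_lifts_def by blast
qed

lemma lifts_translate:
  "(b, t) \<in> lifts n y \<Longrightarrow> (b + 2 * int n * k, t + 2 * int n * k) \<in> lifts n y"
  by (cases "Suc y < n"; cases "Suc y = n")
    (simp_all only: lifts_def simp_thms less_irrefl if_True if_False converse_iff low_lifts_translate mid_lifts_translate)

section \<open>Choosing lifts of the edges\<close>

lemma half_arcs_low_lifts:
  assumes n: "2 \<le> n" and uv: "(u, v) \<in> half_arcs n" "Suc (fst u) < n"
  shows "\<exists>b t. b mod (2 * int n) = abscissa n u mod (2 * int n) \<and> t mod (2 * int n) = abscissa n v mod (2 * int n) \<and>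
    (b, t) \<in> low_lifts n (fst u)"
  using uv(1)
proof (cases rule: half_arcs_cases)
  case (col y c)
  thus ?thesis using low_liftsI(1)[of "int c" n y]
    by (intro exI[of _ "2 * int c"]) (simp add: abscissa_def)
next
  case (diag y c)
  have "Suc c mod n \<noteq> n" using mod_less_divisor[of n "Suc c"] n by linarith
  hence "abscissa n u = 2 * (int (Suc c) mod int n)" using diag by (simp add: abscissa_def zmod_int)
  hence "2 * int (Suc c) mod (2 * int n) = abscissa n u mod (2 * int n)"
    by (simp only: mod_mult_mult1 mod_mod_trivial)
  \<comment> \<open>The bottom end is not reduced modulo \<open>n\<close>: for
    \<open>c = n - 1\<close> it is the lift of column 0 one period to the right.\<close>
  thus ?thesis using diag low_liftsI(2)[of y n "int (Suc c)"]
    by (intro exI[of _ "2 * int (Suc c)"] exI[of _ "2 * int c"]) (simp add: abscissa_def)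
next
  case (apex c)
  have "\<not> Suc (Suc (n - 2)) < n" using n by simp
  from low_liftsI(3,4)[OF this, of 0]
  have "(0, 1) \<in> low_lifts n (n - 2)" "(2, 1) \<in> low_lifts n (n - 2)" by simp_all
  thus ?thesis using apex n
    by (intro exI[of _ "2 * int c"] exI[of _ 1]) (auto simp: abscissa_def)
next
  case (fan c)
  thus ?thesis using uv(2) n by simp
qed

text \<open>The same undirected edges as \<open>arcs n\<close>, with those of the mirrored half
  turned round so that all of them go up one row.\<close>

definition drawn :: "nat \<Rightarrow> ((nat \<times> nat) \<times> (nat \<times> nat)) set" where
  "drawn n = half_arcs n \<union> (\<lambda>(u, v). (mirror n v, mirror n u)) ` half_arcs n"

lemma half_arcs_row:
  assumes "2 \<le> n" "(u, v) \<in> half_arcs n"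
  shows "fst v = Suc (fst u) \<and> fst v \<le> n"
  using assms(2) by (cases rule: half_arcs_cases) (use assms(1) in auto)

lemma drawn_lifts:
  assumes n: "2 \<le> n" and uv: "(u, v) \<in> drawn n"
  shows "\<exists>b t. b mod (2 * int n) = abscissa n u mod (2 * int n) \<and> t mod (2 * int n) = abscissa n v mod (2 * int n) \<and>
    (b, t) \<in> lifts n (fst u)"
proof -
  let ?N = "2 * int n"
  have abscissa_mirror: "abscissa n (mirror n w) = abscissa n w" for w by (simp add: abscissa_def mirror_def split: prod.split)
  consider (low) "(u, v) \<in> half_arcs n"
    | (high) u' v' where "(u', v') \<in> half_arcs n" "u = mirror n v'" "v = mirror n u'"
    using uv by (auto simp: drawn_def)
  thus ?thesis
  proof cases
    case low
    show ?thesis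
    proof (cases "Suc (fst u) < n")
      case True
      thus ?thesis using half_arcs_low_lifts[OF n low] by (simp add: lifts_def)
    next
      case False
      from low obtain c where c: "u = (n - 1, n)" "v = (n, c)" "c < n"
        by (cases rule: half_arcs_cases) (use False n in auto)
      \<comment> \<open>\<open>x\<close> is lifted to 1, and its neighbours must lie to the right of
        it; hence column 0 is lifted to \<open>2 * n\<close>.\<close>
      let ?m = "if c = 0 then int n else int c"
      have "(?N * 0 + 1, 2 * ?m) \<in> mid_lifts n"
        unfolding mid_lifts_def using c(3) by (intro UnI1 CollectI exI conjI refl) auto
      thus ?thesis using c n by (intro exI[of _ 1] exI[of _ "2 * ?m"]) (auto simp: abscissa_def lifts_def)
    qed
  next
    case (high u' v')
    show ?thesis
    proof (cases "Suc (fst u') < n")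
      case True
      obtain b t where bt: "b mod ?N = abscissa n u' mod ?N" "t mod ?N = abscissa n v' mod ?N" "(b, t) \<in> low_lifts n (fst u')"
        using half_arcs_low_lifts[OF n high(1) True] by blast
      have r: "fst u = 2 * n - 2 - fst u'"
        using half_arcs_row[OF n high(1)] high(2) by (simp add: mirror_def split: prod.splits)
      hence "2 * n - 2 - fst u = fst u'" "\<not> Suc (fst u) < n" "Suc (fst u) \<noteq> n" using True by auto
      hence "(t, b) \<in> lifts n (fst u)" using bt by (simp add: lifts_def)
      thus ?thesis using bt high abscissa_mirror by metis
    next
      case False
      from high(1) obtain c where c: "u' = (n - 1, n)" "v' = (n, c)" "c < n"
        by (cases rule: half_arcs_cases) (use False n in auto)
      hence uv': "u = (n - 1, c)" "v = (n, n)" using high n by (auto simp: mirror_def)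
      \<comment> \<open>Here \<open>x'\<close> is lifted to 1 and its neighbours must lie to the
        left, so all columns but 0 move back by one period.\<close>
      let ?m = "if c = 0 then 0 else int c - int n"
      have "(2 * ?m, ?N * 0 + 1) \<in> mid_lifts n"
        unfolding mid_lifts_def using c(3) by (intro UnI2 CollectI exI conjI refl) auto
      moreover have "(2 * int c - ?N) mod ?N = 2 * int c mod ?N"
        by simp
      ultimately show ?thesis using c(3) n
        by (intro exI[of _ "2 * ?m"] exI[of _ 1]) (auto simp: abscissa_def lifts_def uv' algebra_simps)
    qed
  qed
qed

lemma drawn_verts:
  assumes n: "2 \<le> n" and uv: "(u, v) \<in> drawn n"
  shows "u \<in> verts n \<and> v \<in> verts n \<and> fst v = Suc (fst u)"
proof -
  consider (low) "(u, v) \<in> half_arcs n"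
    | (high) u' v' where "(u', v') \<in> half_arcs n" "u = mirror n v'" "v = mirror n u'"
    using uv by (auto simp: drawn_def)
  thus ?thesis
  proof cases
    case low
    thus ?thesis using half_arcs_verts[OF n] half_arcs_row[OF n] by blast
  next
    case (high u' v')
    have "fst v = Suc (fst u)"
      using half_arcs_row[OF n high(1)] high(2,3) n by (auto simp: mirror_def split: prod.splits)
    thus ?thesis using half_arcs_verts[OF n high(1)] mirror_verts[OF n] high by simp
  qed
qed

lemma abscissa_inj:
  assumes n: "2 \<le> n" and uv: "u \<in> verts n" "v \<in> verts n" "fst u = fst v"
    and eq: "abscissa n u mod (2 * int n) = abscissa n v mod (2 * int n)"
  shows "u = v"
proof -
  have "0 \<le> abscissa n w \<and> abscissa n w < 2 * int n" if "w \<in> verts n" for w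
    using that n by (auto simp: verts_def abscissa_def)
  hence "abscissa n u = abscissa n v" using eq uv by (metis mod_pos_pos_trivial)
  hence "snd u = snd v" by (auto simp: abscissa_def split: prod.splits if_splits) presburger+
  thus ?thesis using uv(3) by (simp add: prod_eq_iff)
qed

section \<open>Assembling the posets\<close>

lemma digraph_order_witness:
  fixes lev :: "'a \<Rightarrow> nat"
  assumes fin: "finite A" and E: "E \<subseteq> A \<times> A"
    and grad: "\<And>u v. (u, v) \<in> E \<Longrightarrow> lev u < lev v"
    and lev: "\<And>u. u \<in> A \<Longrightarrow> 1 \<le> lev u \<and> lev u \<le> h"
    and chain: "C \<subseteq> A" "card C = h" "\<And>u v. u \<in> C \<Longrightarrow> v \<in> C \<Longrightarrow> (u, v) \<in> E\<^sup>* \<or> (v, u) \<in> E\<^sup>*"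
    and plan: "planar A {{u, v} | u v. (u, v) \<in> E}"
    and mem: "\<And>i. i \<in> I \<Longrightarrow> a i \<in> A \<and> b i \<in> A"
    and inc: "\<And>i. i \<in> I \<Longrightarrow> (a i, b i) \<notin> E\<^sup>*"
    and cmp: "\<And>i j. i \<in> I \<Longrightarrow> j \<in> I \<Longrightarrow> i \<noteq> j \<Longrightarrow> (a i, b j) \<in> E\<^sup>*"
  shows "\<exists>r. finite A \<and> partial_order_on A r \<and> poset_height r = h \<and>
           planar A (cover_edges r) \<and> card I \<le> poset_dimension A r"
proof -
  let ?r = "digraph_order A E"
  have r: "partial_order_on A ?r" using partial_order_digraph_order[of E lev] grad by blast
  have "poset_height ?r = h"
  proof (rule poset_height_eqI[OF fin r lev])
    show "lev u < lev v" if "(u, v) \<in> ?r" "u \<noteq> v" for u v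
      using rtrancl_graded[of E lev u v] grad that by (auto simp: digraph_order_def)
    show "C \<in> Chains ?r" using chain by (auto simp: Chains_def digraph_order_def)
  qed (use chain in auto)
  moreover have "planar A (cover_edges ?r)"
    using plan
  proof (rule planar_mono)
    show "cover_edges ?r \<subseteq> {{u, v} | u v. (u, v) \<in> E}"
      using cover_rel_digraph_order[OF E, of lev] grad unfolding cover_edges_def by blast
  qed
  moreover have "card I \<le> poset_dimension A ?r"
    by (rule card_le_poset_dimension[OF fin r, where a = a and b = b]) (use mem inc cmp in \<open>auto simp: digraph_order_def\<close>)
  ultimately show ?thesis using fin r by blast
qed

text \<open>A chain of \<open>h\<close> elements and an isolated point: enough for \<open>h \<le> 2\<close>, where the grids degenerate.\<close>

lemma small_witness:
  assumes h: "1 \<le> h"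
  shows "\<exists>(A :: nat set) r. finite A \<and> partial_order_on A r \<and> poset_height r = h \<and>
           planar A (cover_edges r) \<and> 2 \<le> poset_dimension A r"
proof -
  define E where "E = {(i, Suc i) | i. Suc i < h}"
  define row where "row i = (if i = h then 0 else i)" for i :: nat
  have up: "(i, i + d) \<in> E\<^sup>*" if "i + d < h" for i d
    using that
  proof (induction d)
    case (Suc d)
    have "(i, i + d) \<in> E\<^sup>*" using Suc by simp
    moreover have "(i + d, i + Suc d) \<in> E" using Suc.prems by (simp add: E_def)
    ultimately show ?case by (rule rtrancl_into_rtrancl)
  qed simp
  have plan: "planar {..h} {{u, v} | u v. (u, v) \<in> E}"
  proof (rule planar_layered_cylinder[where N = 2 and row = row and
        X = "\<lambda>i. if i = h then 1 else 0" and S = "\<lambda>_. {(2 * k, 2 * k :: int) | k. True}"])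
    fix u v assume uv: "(u, v) \<in> E"
    show "u \<in> {..h} \<and> v \<in> {..h} \<and> row v = Suc (row u)"
      using uv by (auto simp: E_def row_def)
    show "\<exists>b t. b mod 2 = (if u = h then 1 else 0) mod 2 \<and> t mod 2 = (if v = h then 1 else 0) mod 2 \<and>
        (b, t) \<in> {(2 * k, 2 * k :: int) | k. True}"
      using uv by (intro exI[of _ 0]) (auto simp: E_def)
  next
    fix b t k :: int assume "(b, t) \<in> {(2 * k, 2 * k :: int) | k. True}"
    then obtain m where "b + 2 * k = 2 * (m + k)" "t + 2 * k = 2 * (m + k)" by auto
    thus "(b + 2 * k, t + 2 * k) \<in> {(2 * k, 2 * k :: int) | k. True}" by blast
  qed (auto simp: row_def split: if_splits)
  have end_h: "(h, i) \<in> E\<^sup>* \<longleftrightarrow> i = h" "(i, h) \<in> E\<^sup>* \<longleftrightarrow> i = h" for i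
    by (auto simp: E_def elim: converse_rtranclE rtranclE)
  have "\<exists>r. finite {..h} \<and> partial_order_on {..h} r \<and> poset_height r = h \<and>
      planar {..h} (cover_edges r) \<and> card {False, True} \<le> poset_dimension {..h} r"
  \<comment> \<open>The incomparable points \<open>0\<close> and \<open>h\<close>, paired in both
    orders, form a standard example of size 2 whose required comparabilities are mere
    reflexivity.\<close>
  proof (rule digraph_order_witness[where E = E and lev = "\<lambda>i. if i = h then 1 else Suc i" and C = "{..<h}"
        and a = "\<lambda>s. if s then 0 else h" and b = "\<lambda>s. if s then h else 0"])
    show "planar {..h} {{u, v} | u v. (u, v) \<in> E}" by (rule plan)
    show "(u, v) \<in> E\<^sup>* \<or> (v, u) \<in> E\<^sup>*" if "u \<in> {..<h}" "v \<in> {..<h}" for u v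
      using up[of u "v - u"] up[of v "u - v"] that by (cases "u \<le> v") auto
  qed (use h end_h in \<open>auto simp: E_def\<close>)
  moreover have "card {False, True} = 2" by simp
  ultimately show ?thesis by metis
qed

lemma rtrancl_image_inj:
  assumes "inj f"
  shows "(f u, f v) \<in> ((\<lambda>(x, y). (f x, f y)) ` E)\<^sup>* \<longleftrightarrow> (u, v) \<in> E\<^sup>*" (is "_ \<in> ?E\<^sup>* \<longleftrightarrow> _")
proof
  show "(f u, f v) \<in> ?E\<^sup>*" if "(u, v) \<in> E\<^sup>*"
    using that
  proof induction
    case (step v w)
    hence "(f v, f w) \<in> ?E" by force
    with step.IH show ?case by (rule rtrancl_into_rtrancl)
  qed simp
  have "\<exists>v. x = f v \<and> (u, v) \<in> E\<^sup>*" if "(f u, x) \<in> ?E\<^sup>*" for x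
    using that
  proof induction
    case (step x x')
    then obtain v where v: "x = f v" "(u, v) \<in> E\<^sup>*" by blast
    obtain w w' where w: "(w, w') \<in> E" "x = f w" "x' = f w'" using step.hyps(2) by auto
    hence "w = v" using v assms by (simp add: inj_eq)
    hence "(u, w') \<in> E\<^sup>*" using v(2) w(1) by (simp add: rtrancl_into_rtrancl)
    thus ?case using w(3) by blast
  qed blast
  thus "(u, v) \<in> E\<^sup>*" if "(f u, f v) \<in> ?E\<^sup>*" using that assms by (metis inj_eq)
qed

lemma large_witness:
  assumes n: "2 \<le> n"
  shows "\<exists>(A :: nat set) r. finite A \<and> partial_order_on A r \<and> poset_height r = Suc n \<and>
           planar A (cover_edges r) \<and> 2 * n \<le> poset_dimension A r"
proof -
  \<comment> \<open>The vertices are encoded as natural numbers to obtain a carrier of type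
    \<open>nat set\<close>.\<close>
  let ?A = "prod_encode ` verts n"
  let ?E = "(\<lambda>(u, v). (prod_encode u, prod_encode v)) ` arcs n"
  have reach: "(prod_encode u, prod_encode v) \<in> ?E\<^sup>* \<longleftrightarrow> (u, v) \<in> (arcs n)\<^sup>*" for u v
    by (rule rtrancl_image_inj) (rule inj_prod_encode)
  have mirrored: "(mirror n u, mirror n v) \<in> (arcs n)\<^sup>* \<longleftrightarrow> (u, v) \<in> (arcs n)\<^sup>*"
    if "u \<in> verts n" "v \<in> verts n" for u v
    using rtrancl_arcs_mirror[OF n] mirror_mirror[OF n] that by metis
  define bot where "bot i = (0::nat, i)" for i :: nat
  define top where "top i = (n - 1, Suc i mod n)" for i
  have bt_verts: "bot i \<in> verts n" "top i \<in> verts n" if "i < n" for i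
    using that n by (auto simp: bot_def top_def verts_def)
  define a where "a = (\<lambda>(s, i). if s then mirror n (bot i) else bot i)"
  define b where "b = (\<lambda>(s, i). if s then mirror n (top i) else top i)"
  have same: "(bot i, top j) \<in> (arcs n)\<^sup>* \<longleftrightarrow> i \<noteq> j" if "i < n" "j < n" for i j
    using arcs_reach_top[OF n that] arcs_not_reach[OF n that(1)] by (auto simp: bot_def top_def)
  have other: "(bot i, mirror n (top j)) \<in> (arcs n)\<^sup>*" if "i < n" for i j
    using arcs_reach_other[OF n that, of "Suc j mod n"] n by (simp add: top_def bot_def mirror_def)
  have other': "(mirror n (bot i), top j) \<in> (arcs n)\<^sup>*" if "i < n" "j < n" for i j
    using rtrancl_arcs_mirror[OF n other[OF that(1), of j]] mirror_mirror[OF n bt_verts(2)[OF that(2)]] by simp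
  \<comment> \<open>The Boolean selects the copy. Within a copy this is the standard example of size
    \<open>n\<close>; across copies everything is comparable through \<open>x\<close> or
    \<open>x'\<close>.\<close>
  have cmp: "(a p, b q) \<in> (arcs n)\<^sup>* \<longleftrightarrow> p \<noteq> q"
    if "p \<in> UNIV \<times> {..<n}" "q \<in> UNIV \<times> {..<n}" for p q :: "bool \<times> nat"
  proof -
    obtain s i t j where pq: "p = (s, i)" "q = (t, j)" by (cases p, cases q)
    hence ij: "i < n" "j < n" using that by auto
    show ?thesis
      using same[OF ij] other[OF ij(1), of j] other'[OF ij] mirrored[OF bt_verts(1)[OF ij(1)] bt_verts(2)[OF ij(2)]]
      by (cases s; cases t) (simp_all add: pq a_def b_def)
  qed
  have ab_verts: "a p \<in> verts n \<and> b p \<in> verts n" if "p \<in> UNIV \<times> {..<n}" for p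
    using that bt_verts[of "snd p"] mirror_verts[OF n, of "bot (snd p)"] mirror_verts[OF n, of "top (snd p)"]
    by (auto simp: a_def b_def)
  \<comment> \<open>A longest chain: up column 0 to row \<open>n - 2\<close>, then through
    \<open>x\<close> to an element \<open>b'\<close>.\<close>
  let ?C = "(\<lambda>y. (y, 0)) ` {..<n - 1} \<union> {(n - 1, n), (n, 0)}"
  have C_apex: "((y, 0), (n - 1, n)) \<in> (arcs n)\<^sup>*" if "y < n - 1" for y
    using arcs_column[of 0 n y "n - 2 - y"] half_arcs_arcs[OF half_arcsI(3)[of n]] that n
    by (simp add: rtrancl.rtrancl_into_rtrancl)
  have C_last: "((n - 1, n), (n, 0)) \<in> arcs n"
    using half_arcs_arcs[OF half_arcsI(5)[of 0 n]] n by simp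
  have C_end: "((y, 0), (n, 0)) \<in> (arcs n)\<^sup>*" if "y < n - 1" for y
    using C_apex[OF that] C_last by (rule rtrancl_into_rtrancl)
  have C_col: "((y, 0), (z, 0)) \<in> (arcs n)\<^sup>*" if "y \<le> z" "z < n - 1" for y z
    using arcs_column[of 0 n y "z - y"] that by simp
  have C_cols: "((y, 0), (z, 0)) \<in> (arcs n)\<^sup>* \<or> ((z, 0), (y, 0)) \<in> (arcs n)\<^sup>*"
    if "y < n - 1" "z < n - 1" for y z
    using C_col that nat_le_linear by blast
  have chain: "(u, v) \<in> (arcs n)\<^sup>* \<or> (v, u) \<in> (arcs n)\<^sup>*" if "u \<in> ?C" "v \<in> ?C" for u v
    using that C_apex C_end C_cols r_into_rtrancl[OF C_last] by auto
  have "\<exists>r. finite ?A \<and> partial_order_on ?A r \<and> poset_height r = Suc n \<and>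
      planar ?A (cover_edges r) \<and> card ((UNIV :: bool set) \<times> {..<n}) \<le> poset_dimension ?A r"
  proof (rule digraph_order_witness[where E = ?E and lev = "level n \<circ> prod_decode" and C = "prod_encode ` ?C"
        and a = "prod_encode \<circ> a" and b = "prod_encode \<circ> b"])
    show "finite ?A" by (simp add: finite_verts)
    show "?E \<subseteq> ?A \<times> ?A" using arcs_verts[OF n] by auto
    show "(level n \<circ> prod_decode) u < (level n \<circ> prod_decode) v" if "(u, v) \<in> ?E" for u v
      using that level_arcs[OF n] by auto
    show "1 \<le> (level n \<circ> prod_decode) u \<and> (level n \<circ> prod_decode) u \<le> Suc n" if "u \<in> ?A" for u
      using that level_verts[OF n] by auto
    show "prod_encode ` ?C \<subseteq> ?A" using n by (intro image_mono) (auto simp: verts_def)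
    have "card ?C = Suc n"
    proof -
      have "card ((\<lambda>y. (y, 0::nat)) ` {..<n - 1}) = n - 1" by (simp add: card_image inj_on_def)
      thus ?thesis using n by (subst card_Un_disjoint) auto
    qed
    thus "card (prod_encode ` ?C) = Suc n" by (subst card_image) (auto intro: inj_prod_encode)
    show "(u, v) \<in> ?E\<^sup>* \<or> (v, u) \<in> ?E\<^sup>*" if "u \<in> prod_encode ` ?C" "v \<in> prod_encode ` ?C" for u v
      using that chain by (elim imageE) (simp only: reach)
    show "planar ?A {{u, v} | u v. (u, v) \<in> ?E}"
    proof -
      let ?F = "(\<lambda>(u, v). (prod_encode u, prod_encode v)) ` drawn n"
      have "planar ?A {{u, v} | u v. (u, v) \<in> ?F}"
      proof (rule planar_layered_cylinder[where N = "2 * int n" and row = "fst \<circ> prod_decode" and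
            X = "abscissa n \<circ> prod_decode" and S = "lifts n"])
        show "u = v" if "u \<in> ?A" "v \<in> ?A" "(fst \<circ> prod_decode) u = (fst \<circ> prod_decode) v"
          "(abscissa n \<circ> prod_decode) u mod (2 * int n) = (abscissa n \<circ> prod_decode) v mod (2 * int n)" for u v
          using that abscissa_inj[OF n] by auto
        show "u \<in> ?A \<and> v \<in> ?A \<and> (fst \<circ> prod_decode) v = Suc ((fst \<circ> prod_decode) u)"
          if "(u, v) \<in> ?F" for u v
          using that drawn_verts[OF n] by auto
        show "\<exists>b t. b mod (2 * int n) = (abscissa n \<circ> prod_decode) u mod (2 * int n) \<and>
            t mod (2 * int n) = (abscissa n \<circ> prod_decode) v mod (2 * int n) \<and>
            (b, t) \<in> lifts n ((fst \<circ> prod_decode) u)" if uv: "(u, v) \<in> ?F" for u v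
        proof -
          from uv obtain e where e: "e \<in> drawn n" "(u, v) = (prod_encode (fst e), prod_encode (snd e))"
            by (auto simp: case_prod_beta)
          hence "(fst e, snd e) \<in> drawn n" by simp
          from drawn_lifts[OF n this] show ?thesis using e(2) by simp
        qed
      qed (use n lifts_translate lifts_mono[OF n] in auto)
      moreover have "{{u, v} | u v. (u, v) \<in> ?E} \<subseteq> {{u, v} | u v. (u, v) \<in> ?F}"
      proof
        have F: "(prod_encode x, prod_encode y) \<in> ?F" if "(x, y) \<in> drawn n" for x y
          using that by (rule rev_image_eqI) simp
        fix e assume "e \<in> {{u, v} | u v. (u, v) \<in> ?E}"
        then obtain x y where "(x, y) \<in> ?E" "e = {x, y}" by blast
        then obtain p where p: "p \<in> arcs n" "e = {prod_encode (fst p), prod_encode (snd p)}"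
          by (auto simp: case_prod_beta)
        define u v where "u = fst p" "v = snd p"
        with p have uv: "(u, v) \<in> arcs n" "e = {prod_encode u, prod_encode v}" by simp_all
        from uv(1) show "e \<in> {{u, v} | u v. (u, v) \<in> ?F}"
        proof (cases rule: arcs_cases)
          case 1
          hence "(u, v) \<in> drawn n" by (simp add: drawn_def)
          from F[OF this] show ?thesis using uv(2) by blast
        next
          case (2 u' v')
          have "(v, u) \<in> drawn n"
            unfolding drawn_def by (rule UnI2, rule rev_image_eqI[OF 2(1)]) (simp add: 2)
          from F[OF this] show ?thesis using uv(2) by blast
        qed
      qed
      ultimately show ?thesis by (rule planar_mono)
    qed
    show "(prod_encode \<circ> a) p \<in> ?A \<and> (prod_encode \<circ> b) p \<in> ?A" if "p \<in> UNIV \<times> {..<n}" for p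
      using ab_verts[OF that] by simp
    show "((prod_encode \<circ> a) p, (prod_encode \<circ> b) p) \<notin> ?E\<^sup>*" if "p \<in> UNIV \<times> {..<n}" for p
      unfolding comp_apply reach using cmp[OF that that] by simp
    show "((prod_encode \<circ> a) p, (prod_encode \<circ> b) q) \<in> ?E\<^sup>*"
      if "p \<in> UNIV \<times> {..<n}" "q \<in> UNIV \<times> {..<n}" "p \<noteq> q" for p q
      unfolding comp_apply reach using cmp[OF that(1,2)] that(3) by simp
  qed
  moreover have "card ((UNIV :: bool set) \<times> {..<n}) = 2 * n"
    by (simp add: card_cartesian_product)
  ultimately show ?thesis by metis
qed

theorem theorem3:
  fixes h :: nat
  assumes "h \<ge> 1"
  shows "\<exists>(A :: nat set) r. finite A \<and> partial_order_on A r \<and> poset_height r = h \<and>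
           planar A (cover_edges r) \<and> poset_dimension A r \<ge> 2 * h - 2"
proof (cases "h \<le> 2")
  case True
  obtain A :: "nat set" and r where "finite A" "partial_order_on A r" "poset_height r = h"
    "planar A (cover_edges r)" "2 \<le> poset_dimension A r"
    using small_witness[OF assms] by blast
  thus ?thesis using True by (intro exI[of _ A] exI[of _ r]) auto
next
  case False
  hence "2 \<le> h - 1" by simp
  moreover have "Suc (h - 1) = h" "2 * (h - 1) = 2 * h - 2" using assms by simp_all
  ultimately show ?thesis using large_witness[of "h - 1"] by (simp only:)
qed

end
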